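(* Let $N\ge 1$ be an integer and $\beta\ge 0$. The fundamental Robin eigenvalue $\lambda_1(\Omega(\mathbf a))=\sum_{j=1}^N\mu(a_j)^2$ of the box $\Omega(\mathbf a)$ is a convex function of $(\ell_1,\dots,\ell_N)\in\mathbb{R}^N$, where $\ell_j=\log(a_j)$. Equivalently, for any $\mathbf a(0)=(a_j(0))_{j=1}^N$ and $\mathbf a(1)=(a_j(1))_{j=1}^N$ with positive entries, setting $\mathbf a(t)=\bigl(a_j(0)^{1-t}a_j(1)^t\bigr)_{j=1}^N$, $$\lambda_1(\Omega(\mathbf a(t)))\le(1-t)\,\lambda_1(\Omega(\mathbf a(0)))+t\,\lambda_1(\Omega(\mathbf a(1)))\qquad\text{for } 0<t<1.$$
   Context: For $\mathbf a=(a_1,\dots,a_N)$ with all $a_j>0$, the box is $\Omega(\mathbf a)=(-a_1,a_1)\times\cdots\times(-a_N,a_N)\subset\mathbb{R}^N$. For given $\beta\ge 0$, $\lambda_1(\Omega)$ denotes the fundamental (smallest) Robin eigenvalue of the Laplacian, i.e. the smallest $\lambda$ for which there is a function $u$, not identically zero, with $\Delta u+\lambda u=0$ in $\Omega$ and $\beta\,\partial u/\partial n+u=0$ on $\partial\Omega$ ($n$ the outward normal). For boxes it is given by the explicit formula $\lambda_1(\Omega(\mathbf a))=\sum_{j=1}^N\mu(a_j)^2$, where, if $\beta>0$, $\mu(c)$ is the unique solution in $(0,\pi/(2c))$ of $\mu\tan(c\mu)=1/\beta$, and, if $\beta=0$, $\mu(c)=\pi/(2c)$. *)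

theory Defs
  imports "HOL-Analysis.Analysis"
begin

text \<open>
  Outward unit normal at a differentiable boundary point: to first order at \<open>x\<close>, the set \<open>\<Omega>\<close>
  is the half-space \<open>{y. (y - x) \<bullet> n < 0}\<close>. On a box this holds exactly on the relatively open
  faces; a boundary condition holding there passes to edges and corners by continuity.
\<close>

definition outward_normal :: "'a::euclidean_space set \<Rightarrow> 'a \<Rightarrow> 'a \<Rightarrow> bool" where
  "outward_normal \<Omega> x n \<longleftrightarrow>
     x \<in> frontier \<Omega> \<and> norm n = 1 \<and>
     (\<forall>\<epsilon>>0. \<exists>\<delta>>0. \<forall>y\<in>ball x \<delta>.
        ((y - x) \<bullet> n < - \<epsilon> * norm (y - x) \<longrightarrow> y \<in> \<Omega>) \<and>
        ((y - x) \<bullet> n > \<epsilon> * norm (y - x) \<longrightarrow> y \<notin> \<Omega>))"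

text \<open>
  Classical Robin eigenfunctions: \<open>u\<close> is of class \<open>C\<^sup>2\<close> in \<open>\<Omega>\<close> and of class \<open>C\<^sup>1\<close> up to the
  boundary. The function \<open>g\<close> is the gradient of \<open>u\<close>, extended continuously to the closure (so
  that \<open>g x \<bullet> n\<close> is the normal derivative at a boundary point), and \<open>H x\<close> is the Hessian, whose
  trace is the Laplacian. The values of \<open>u\<close> outside the closure of \<open>\<Omega>\<close> play no role.
\<close>

definition robin_eigenfunction ::
    "real \<Rightarrow> 'a::euclidean_space set \<Rightarrow> real \<Rightarrow> ('a \<Rightarrow> real) \<Rightarrow> bool" where
  "robin_eigenfunction \<beta> \<Omega> lam u \<longleftrightarrow>
     (\<exists>x\<in>\<Omega>. u x \<noteq> 0) \<and>
     (\<exists>(g :: 'a \<Rightarrow> 'a) (H :: 'a \<Rightarrow> 'a \<Rightarrow> 'a).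
        continuous_on (closure \<Omega>) u \<and>
        continuous_on (closure \<Omega>) g \<and>
        (\<forall>h. continuous_on \<Omega> (\<lambda>x. H x h)) \<and>
        (\<forall>x\<in>\<Omega>. (u has_derivative (\<lambda>h. g x \<bullet> h)) (at x)) \<and>
        (\<forall>x\<in>\<Omega>. (g has_derivative H x) (at x)) \<and>
        (\<forall>x\<in>\<Omega>. (\<Sum>b\<in>Basis. H x b \<bullet> b) + lam * u x = 0) \<and>
        (\<forall>x\<in>frontier \<Omega>. \<forall>n. outward_normal \<Omega> x n \<longrightarrow> \<beta> * (g x \<bullet> n) + u x = 0))"

definition robin_eigenvalue :: "real \<Rightarrow> 'a::euclidean_space set \<Rightarrow> real \<Rightarrow> bool" where
  "robin_eigenvalue \<beta> \<Omega> lam \<longleftrightarrow> (\<exists>u. robin_eigenfunction \<beta> \<Omega> lam u)"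

definition robin_lambda1 :: "real \<Rightarrow> 'a::euclidean_space set \<Rightarrow> real" where
  "robin_lambda1 \<beta> \<Omega> = (LEAST lam. robin_eigenvalue \<beta> \<Omega> lam)"

definition robin_mu :: "real \<Rightarrow> real \<Rightarrow> real" where
  "robin_mu \<beta> c =
     (if \<beta> = 0 then pi / (2 * c)
      else (THE m. m \<in> {0<..<pi / (2 * c)} \<and> m * tan (c * m) = 1 / \<beta>))"

definition centered_box :: "real ^ 'n \<Rightarrow> (real ^ 'n) set" where
  "centered_box a = box (- a) a"

end

theory Submission
  imports Defs
begin

text \<open>
  Two facts are combined: the first Robin eigenvalue of a box splits into one-dimensional
  eigenvalues, and each of these is convex in the logarithm of the side length.

  Write \<open>\<mu>\<^sub>b\<close> for the one-dimensional frequency \<open>\<mu>(a\<^sub>b)\<close>. The product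
  \<open>\<Prod>\<^sub>b cos (\<mu>\<^sub>b x\<^sub>b)\<close> is a Robin eigenfunction with eigenvalue \<open>\<Sum>\<^sub>b \<mu>\<^sub>b\<^sup>2\<close>
  (\<open>robin_eigenvalue_box\<close>). That no eigenvalue is smaller (\<open>robin_eigenvalue_box_ge\<close>) comes from
  a maximum principle. Shrink all frequencies by a common factor below \<open>1\<close>, to \<open>m\<^sub>b\<close>. The product
  \<open>\<phi> = \<Prod>\<^sub>b cos (m\<^sub>b x\<^sub>b)\<close> is then positive on the closed box and satisfies the strict
  boundary inequality \<open>\<beta> \<partial>\<phi>/\<partial>n + \<phi> > 0\<close>. Let \<open>u\<close> be an eigenfunction for \<open>\<lambda>\<close>, positive somewhere,
  and let \<open>M > 0\<close> be the maximum of \<open>u / \<phi>\<close> on the closed box, so that \<open>u - M \<phi>\<close> has the maximum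
  value \<open>0\<close>. On the boundary the first-order condition at a maximum point, together with the Robin
  condition for \<open>u\<close>, contradicts the strict inequality. At an interior maximum point the
  Laplacian of \<open>u - M \<phi>\<close> is at most \<open>0\<close>, which says \<open>(\<Sum>\<^sub>b m\<^sub>b\<^sup>2 - \<lambda>) u \<le> 0\<close> there, hence
  \<open>\<lambda> \<ge> \<Sum>\<^sub>b m\<^sub>b\<^sup>2\<close>. Letting the factor tend to \<open>1\<close> gives the bound. The boundary
  inequality reads the same for \<open>\<beta> = 0\<close>, so that one argument covers Dirichlet and Robin conditions.

  For the convexity when \<open>\<beta> > 0\<close>, use \<open>\<theta> = c \<mu>(c) \<in> (0, \<pi>/2)\<close> as a parameter: since
  \<open>\<theta> tan \<theta> = c / \<beta>\<close>,
  the graph of \<open>\<mu>(exp l)\<^sup>2\<close> over \<open>l = ln c\<close> is the curve with abscissa \<open>ln \<beta> + ln \<theta> + ln (tan \<theta>)\<close> and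
  ordinate \<open>1 / (\<beta> tan \<theta>)\<^sup>2\<close>. Its slope is
  \<open>- (2 / \<beta>\<^sup>2) / (tan\<^sup>2 \<theta> + sin\<^sup>2 \<theta> \<sqdot> tan \<theta> / \<theta>)\<close>, which increases with \<open>\<theta>\<close> because every
  factor in the denominator is positive and increasing. A curve that moves to the right with
  increasing slope lies above its tangents (\<open>parametric_curve_above_tangent\<close>), and this is
  convexity. For \<open>\<beta> = 0\<close> the function is a multiple of \<open>exp (- 2 l)\<close>.
\<close>

section \<open>Conditions at a maximum point\<close>

text \<open>
  Moving from the maximum point straight towards an interior point cannot increase \<open>v\<close>. The
  segment lies in \<open>S\<close> except perhaps for its starting point, so the mean value theorem applies even though
  \<open>v\<close> is differentiable only inside, and the continuous extension of the gradient carries the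
  inequality to the starting point. On a box this covers maxima on faces, edges and corners alike.
\<close>
lemma max_point_first_order:
  fixes v :: "'a::euclidean_space \<Rightarrow> real"
  assumes S: "open S" "convex S"
    and cv: "continuous_on (closure S) v" and cg: "continuous_on (closure S) g"
    and dv: "\<And>x. x \<in> S \<Longrightarrow> (v has_derivative (\<lambda>h. g x \<bullet> h)) (at x)"
    and x: "x \<in> closure S" and mx: "\<And>y. y \<in> closure S \<Longrightarrow> v y \<le> v x"
    and z: "z \<in> closure S"
  shows "g x \<bullet> (z - x) \<le> 0"
proof -
  have inner: "g x \<bullet> (z - x) \<le> 0" if z: "z \<in> S" for z
  proof (rule ccontr)
    assume "\<not> ?thesis"
    then have pos: "g x \<bullet> (z - x) > 0" by simp
    define y where "y s = x + s *\<^sub>R (z - x)" for s :: real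
    have y0: "y 0 = x" by (simp add: y_def)
    have yS: "y s \<in> S" if "0 < s" "s \<le> 1" for s
    proof -
      have "x - s *\<^sub>R (x - z) \<in> interior S"
        using mem_interior_closure_convex_shrink[of S z x s] S z x that by (simp add: interior_open)
      then show ?thesis using S by (simp add: y_def interior_open algebra_simps)
    qed
    have yc: "y s \<in> closure S" if "s \<in> {0..1}" for s
      using that yS[of s] x y0 closure_subset[of S] by (cases "s = 0") auto
    have cy: "continuous_on {0..1} y" unfolding y_def by (intro continuous_intros)
    have img: "y ` {0..1} \<subseteq> closure S" using yc by auto
    have cvy: "continuous_on {0..1} (\<lambda>s. v (y s))"
      using continuous_on_compose2[OF cv cy img] .
    have "continuous_on {0..1} (\<lambda>s. g (y s) \<bullet> (z - x))"
      by (intro continuous_intros continuous_on_compose2[OF cg cy img])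
    then have "((\<lambda>s. g (y s) \<bullet> (z - x)) \<longlongrightarrow> g (y 0) \<bullet> (z - x)) (at 0 within {0..1})"
      by (simp add: continuous_on_def)
    then have "\<forall>\<^sub>F s in at 0 within {0..1}. g (y s) \<bullet> (z - x) > 0"
      using pos y0 by (auto elim: order_tendstoD)
    then obtain d where d: "d > 0" "\<And>s. s \<in> {0..1} \<Longrightarrow> s \<noteq> 0 \<Longrightarrow> dist s 0 < d \<Longrightarrow> g (y s) \<bullet> (z - x) > 0"
      unfolding eventually_at by blast
    define e where "e = min 1 (d / 2)"
    have e: "0 < e" "e \<le> 1" "e < d" using d(1) by (auto simp: e_def)
    have "((\<lambda>s. v (y s)) has_derivative (\<lambda>h. g (y s) \<bullet> (h *\<^sub>R (z - x)))) (at s)"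
      if "0 < s" "s < e" for s
    proof -
      have "(y has_derivative (\<lambda>h. h *\<^sub>R (z - x))) (at s)"
        unfolding y_def by (auto intro!: derivative_eq_intros)
      moreover have "(v has_derivative (\<lambda>h. g (y s) \<bullet> h)) (at (y s))"
        using dv yS that e by auto
      ultimately show ?thesis by (rule has_derivative_compose)
    qed
    moreover have "continuous_on {0..e} (\<lambda>s. v (y s))"
      using cvy by (rule continuous_on_subset) (use e in auto)
    ultimately obtain \<xi> where \<xi>: "\<xi> \<in> {0<..<e}"
      "v (y e) - v (y 0) = g (y \<xi>) \<bullet> ((e - 0) *\<^sub>R (z - x))"
      using mvt[of 0 e "\<lambda>s. v (y s)" "\<lambda>s h. g (y s) \<bullet> (h *\<^sub>R (z - x))"] e by auto
    have "g (y \<xi>) \<bullet> (z - x) > 0" using d(2)[of \<xi>] e \<xi>(1) by auto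
    then have "e * (g (y \<xi>) \<bullet> (z - x)) > 0" using e(1) by (intro mult_pos_pos)
    then have "v (y e) > v x" using \<xi>(2) unfolding y0 inner_scaleR_right diff_zero by linarith
    with mx[OF yc[of e]] e show False by auto
  qed
  have "closure S \<subseteq> {z. g x \<bullet> (z - x) \<le> 0}"
  proof (rule closure_minimal)
    show "closed {z. g x \<bullet> (z - x) \<le> 0}"
      by (intro closed_Collect_le continuous_intros)
  qed (use inner in auto)
  with z show ?thesis by auto
qed

text \<open>
  Along a line through the maximum point the derivative of \<open>v\<close> vanishes there; a positive second
  derivative would make it positive just beyond, so that \<open>v\<close> would exceed its maximum.
\<close>
lemma max_point_second_order:
  fixes v :: "'a::euclidean_space \<Rightarrow> real"
  assumes S: "open S" and x: "x \<in> S" and mx: "\<And>y. y \<in> S \<Longrightarrow> v y \<le> v x"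
    and dv: "\<And>x. x \<in> S \<Longrightarrow> (v has_derivative (\<lambda>h. g x \<bullet> h)) (at x)"
    and dg: "(g has_derivative H) (at x)"
  shows "H b \<bullet> b \<le> 0"
proof (rule ccontr)
  assume "\<not> ?thesis"
  then have pos: "H b \<bullet> b > 0" by simp
  define y where "y s = x + s *\<^sub>R b" for s :: real
  have y0: "y 0 = x" by (simp add: y_def)
  have dy: "(y has_derivative (\<lambda>h. h *\<^sub>R b)) (at s)" for s
    unfolding y_def by (auto intro!: derivative_eq_intros)
  have "open (y -` S)"
    unfolding y_def[abs_def] by (intro open_vimage S continuous_intros)
  moreover have "0 \<in> y -` S" using x y0 by simp
  ultimately obtain r where r0: "r > 0" "ball 0 r \<subseteq> y -` S"
    unfolding open_contains_ball by blast
  have r: "r > 0" "\<And>s. \<bar>s\<bar> < r \<Longrightarrow> y s \<in> S"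
    using r0 by (auto simp: subset_iff)
  have dvy: "((\<lambda>s. v (y s)) has_real_derivative g (y s) \<bullet> b) (at s)" if "\<bar>s\<bar> < r" for s
  proof -
    have "((\<lambda>s. v (y s)) has_derivative (\<lambda>h. g (y s) \<bullet> (h *\<^sub>R b))) (at s)"
      by (rule has_derivative_compose[OF dy dv[OF r(2)[OF that]]])
    then show ?thesis
      by (simp add: has_field_derivative_def mult.commute[of _ "g (y s) \<bullet> b"] fun_eq_iff)
  qed
  have H: "linear H" using dg by (simp add: has_derivative_linear)
  have dgy: "((\<lambda>s. g (y s) \<bullet> b) has_real_derivative H b \<bullet> b) (at 0)"
  proof -
    have "((\<lambda>s. g (y s)) has_derivative (\<lambda>h. H (h *\<^sub>R b))) (at 0)"
      using has_derivative_compose[OF dy, of g H] dg y0 by simp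
    then have "((\<lambda>s. g (y s) \<bullet> b) has_derivative (\<lambda>h. H (h *\<^sub>R b) \<bullet> b)) (at 0)"
      by (rule has_derivative_inner_left)
    then show ?thesis
      by (simp add: has_field_derivative_def linear_cmul[OF H] mult.commute[of _ "H b \<bullet> b"] fun_eq_iff)
  qed
  have crit: "g (y 0) \<bullet> b = 0"
  proof (rule DERIV_local_max[OF dvy r(1)])
    show "\<forall>s. \<bar>0 - s\<bar> < r \<longrightarrow> v (y s) \<le> v (y 0)"
      unfolding y0 by (intro allI impI mx r(2)) simp
  qed (use r(1) in simp)
  obtain d where d: "d > 0" "\<And>h. 0 < h \<Longrightarrow> h < d \<Longrightarrow> 0 < g (y h) \<bullet> b"
    using DERIV_pos_inc_right[OF dgy pos] crit by auto
  define e where "e = min (r / 2) (d / 2)"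
  have e: "0 < e" "e < r" "e < d" using d(1) r(1) by (auto simp: e_def)
  have "v (y 0) < v (y e)"
  proof (rule DERIV_pos_imp_increasing_open[OF e(1)])
    show "\<exists>D. ((\<lambda>s. v (y s)) has_real_derivative D) (at s) \<and> D > 0" if "0 < s" "s < e" for s
      using dvy[of s] d(2)[of s] that e by auto
    show "continuous_on {0..e} (\<lambda>s. v (y s))"
      by (rule DERIV_continuous_on[where D="\<lambda>s. g (y s) \<bullet> b"])
        (rule has_field_derivative_at_within[OF dvy], use e in simp)
  qed
  with mx[OF r(2)[of e]] e y0 show False by auto
qed

section \<open>Separable products\<close>

definition separable_prod :: "('a \<Rightarrow> real \<Rightarrow> real) \<Rightarrow> 'a::euclidean_space \<Rightarrow> real" where
  "separable_prod F x = (\<Prod>b\<in>Basis. F b (x \<bullet> b))"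

lemma separable_prod_upd:
  assumes "b \<in> Basis"
  shows "separable_prod (F(b := f)) x = f (x \<bullet> b) * (\<Prod>b'\<in>Basis - {b}. F b' (x \<bullet> b'))"
  unfolding separable_prod_def using assms
  by (subst prod.remove[of _ b]) (auto intro!: prod.cong)

lemma separable_prod_remove:
  assumes "b \<in> Basis"
  shows "separable_prod F x = F b (x \<bullet> b) * (\<Prod>b'\<in>Basis - {b}. F b' (x \<bullet> b'))"
  using separable_prod_upd[OF assms, of F "F b"] by simp

text \<open>
  Each partial derivative replaces a single factor by its derivative and so is again a separable
  product. Hence the same rule also differentiates the gradient.
\<close>
lemma has_derivative_separable_prod:
  assumes "\<And>b t. b \<in> Basis \<Longrightarrow> (F b has_real_derivative F' b t) (at t)"
  shows "(separable_prod F has_derivative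
          (\<lambda>h. \<Sum>b\<in>Basis. (h \<bullet> b) * separable_prod (F(b := F' b)) x)) (at x)"
proof -
  have d: "((\<lambda>x. F b (x \<bullet> b)) has_derivative (\<lambda>h. (h \<bullet> b) * F' b (x \<bullet> b))) (at x)"
    if "b \<in> Basis" for b
    by (rule has_derivative_eq_rhs[OF DERIV_compose_FDERIV[OF assms[OF that]]])
      (auto intro!: derivative_eq_intros)
  show ?thesis
    unfolding separable_prod_def[of F, abs_def]
    by (rule has_derivative_eq_rhs[OF has_derivative_prod[OF d]])
      (auto simp: separable_prod_upd mult.assoc intro!: ext sum.cong)
qed

lemma continuous_on_separable_prod:
  assumes "\<And>b. b \<in> Basis \<Longrightarrow> continuous_on UNIV (F b)"
  shows "continuous_on S (separable_prod F)"
  unfolding separable_prod_def[abs_def]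
  by (intro continuous_intros continuous_on_compose2[OF assms]) auto

definition cos_prod :: "('a \<Rightarrow> real) \<Rightarrow> 'a::euclidean_space \<Rightarrow> real" where
  "cos_prod m = separable_prod (\<lambda>b t. cos (m b * t))"

definition cos_prod_grad :: "('a \<Rightarrow> real) \<Rightarrow> 'a::euclidean_space \<Rightarrow> 'a" where
  "cos_prod_grad m x =
     (\<Sum>b\<in>Basis. separable_prod ((\<lambda>b t. cos (m b * t))(b := \<lambda>t. - m b * sin (m b * t))) x *\<^sub>R b)"

text \<open>
  The derivative of the gradient of \<open>cos_prod\<close>, in the form in which
  \<open>has_derivative_separable_prod\<close> produces it: in the \<open>b\<close>-th component of the gradient the factor
  of index \<open>b\<close> is already a derivative, so differentiating in direction \<open>b\<close> once more gives the
  second derivative of the cosine.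
\<close>
definition cos_prod_hess :: "('a \<Rightarrow> real) \<Rightarrow> 'a::euclidean_space \<Rightarrow> 'a \<Rightarrow> 'a" where
  "cos_prod_hess m x h =
     (\<Sum>b\<in>Basis. (\<Sum>b'\<in>Basis. (h \<bullet> b') *
         separable_prod (((\<lambda>b t. cos (m b * t))(b := \<lambda>t. - m b * sin (m b * t)))
            (b' := ((\<lambda>b t. - m b * sin (m b * t))(b := \<lambda>t. - (m b)\<^sup>2 * cos (m b * t))) b')) x) *\<^sub>R b)"

lemma cos_prod_grad_component:
  assumes "b \<in> Basis"
  shows "cos_prod_grad m x \<bullet> b = - m b * sin (m b * (x \<bullet> b)) * (\<Prod>b'\<in>Basis - {b}. cos (m b' * (x \<bullet> b')))"
  using assms by (simp only: cos_prod_grad_def inner_sum_left_Basis separable_prod_upd)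

lemma has_derivative_cos_prod:
  "(cos_prod m has_derivative (\<lambda>h. cos_prod_grad m x \<bullet> h)) (at x)"
proof -
  have "(cos_prod m has_derivative (\<lambda>h. \<Sum>b\<in>Basis. (h \<bullet> b) *
     separable_prod ((\<lambda>b t. cos (m b * t))(b := (\<lambda>t. - m b * sin (m b * t)))) x)) (at x)"
    unfolding cos_prod_def
    by (rule has_derivative_separable_prod[where F' = "\<lambda>b t. - m b * sin (m b * t)"])
      (auto intro!: derivative_eq_intros)
  then show ?thesis
    by (rule has_derivative_eq_rhs)
      (simp add: cos_prod_grad_def inner_sum_right inner_commute[of _ h for h] fun_eq_iff mult_ac)
qed

lemma has_derivative_cos_prod_grad:
  "(cos_prod_grad m has_derivative cos_prod_hess m x) (at x)"
  unfolding cos_prod_grad_def[abs_def] cos_prod_hess_def[abs_def]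
  by (intro has_derivative_sum has_derivative_scaleR_left has_derivative_separable_prod)
    (auto intro!: derivative_eq_intros simp: power2_eq_square)

lemma cos_prod_hess_trace:
  "(\<Sum>b\<in>Basis. cos_prod_hess m x b \<bullet> b) = - (\<Sum>b\<in>Basis. (m b)\<^sup>2) * cos_prod m x"
proof -
  have "cos_prod_hess m x b \<bullet> b = - (m b)\<^sup>2 * cos_prod m x" if b: "b \<in> Basis" for b
  proof -
    have "cos_prod_hess m x b \<bullet> b = (\<Sum>b'\<in>Basis. (b \<bullet> b') *
         separable_prod (((\<lambda>b t. cos (m b * t))(b := \<lambda>t. - m b * sin (m b * t)))
            (b' := ((\<lambda>b t. - m b * sin (m b * t))(b := \<lambda>t. - (m b)\<^sup>2 * cos (m b * t))) b')) x)"
      unfolding cos_prod_hess_def using b by (simp only: inner_sum_left_Basis)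
    also have "\<dots> = separable_prod ((\<lambda>b t. cos (m b * t))(b := \<lambda>t. - (m b)\<^sup>2 * cos (m b * t))) x"
      using b by (subst sum.remove[of _ b]) (auto simp: inner_Basis intro!: sum.neutral split: if_splits)
    also have "\<dots> = - (m b)\<^sup>2 * cos_prod m x"
      using b by (simp add: separable_prod_upd cos_prod_def separable_prod_remove[OF b, of "\<lambda>b t. cos (m b * t)"])
    finally show ?thesis .
  qed
  then show ?thesis by (simp add: sum_distrib_right sum_negf)
qed

lemma continuous_on_cos_prod: "continuous_on S (cos_prod m)"
  unfolding cos_prod_def by (intro continuous_on_separable_prod continuous_intros)

lemma continuous_on_cos_prod_grad: "continuous_on S (cos_prod_grad m)"
  unfolding cos_prod_grad_def[abs_def]
  by (intro continuous_intros continuous_on_separable_prod) (auto intro!: continuous_intros)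

lemma continuous_on_cos_prod_hess: "continuous_on S (\<lambda>x. cos_prod_hess m x h)"
  unfolding cos_prod_hess_def
  by (intro continuous_intros continuous_on_separable_prod) (auto intro!: continuous_intros)

section \<open>Outward normals\<close>

text \<open>
  The box lies on one side of the hyperplane through the face, so no direction \<open>h\<close> that leaves through
  it can satisfy \<open>h \<bullet> n < 0\<close>. The direction \<open>\<sigma> b - n\<close> would do so, were \<open>n\<close> a unit vector
  other than \<open>\<sigma> b\<close>. Applied to two faces that meet at \<open>x\<close>, this also shows that an edge point has no outward normal.
\<close>
lemma outward_normal_box_unique:
  fixes a :: "'a::euclidean_space"
  assumes n: "outward_normal (box (- a) a) x n" and b: "b \<in> Basis"
    and \<sigma>: "\<bar>\<sigma>\<bar> = 1" and xb: "x \<bullet> b = \<sigma> * (a \<bullet> b)"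
  shows "n = \<sigma> *\<^sub>R b"
proof -
  have \<sigma>2: "\<sigma> * \<sigma> = 1" using \<sigma> by (metis abs_mult_self_eq mult_1)
  have n1: "norm n = 1" using n by (simp add: outward_normal_def)
  have "(\<sigma> *\<^sub>R b) \<bullet> n \<ge> 1"
  proof (rule ccontr)
    assume "\<not> ?thesis"
    then have lt: "(\<sigma> *\<^sub>R b) \<bullet> n < 1" by simp
    define h where "h = \<sigma> *\<^sub>R b - n"
    have hn: "h \<bullet> n = (\<sigma> *\<^sub>R b) \<bullet> n - 1"
      using n1 by (simp add: h_def inner_diff_left norm_eq_1)
    have hb: "\<sigma> * (h \<bullet> b) = 1 - (\<sigma> *\<^sub>R b) \<bullet> n"
      using b \<sigma>2 by (simp add: h_def inner_diff_left inner_commute algebra_simps)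
    have h0: "h \<noteq> 0" using hn lt by auto
    \<comment> \<open>Half of \<open>- h \<bullet> n / norm h\<close>, so that the whole ray along \<open>h\<close> meets the strict cone condition.\<close>
    define \<epsilon> where "\<epsilon> = (- (h \<bullet> n)) / (2 * norm h)"
    have \<epsilon>: "\<epsilon> > 0" using hn lt h0 by (simp add: \<epsilon>_def)
    obtain \<delta> where \<delta>: "\<delta> > 0" "\<And>y. y \<in> ball x \<delta> \<Longrightarrow> (y - x) \<bullet> n < - \<epsilon> * norm (y - x) \<Longrightarrow> y \<in> box (- a) a"
      using n \<epsilon> unfolding outward_normal_def by meson
    define s where "s = \<delta> / (2 * norm h)"
    have s: "s > 0" using \<delta> h0 by (simp add: s_def)
    have "x + s *\<^sub>R h \<in> box (- a) a"
    proof (rule \<delta>(2))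
      show "x + s *\<^sub>R h \<in> ball x \<delta>" using \<delta>(1) h0 s by (simp add: dist_norm s_def)
      have "\<epsilon> * norm h = - (h \<bullet> n) / 2" using h0 by (simp add: \<epsilon>_def)
      then have "h \<bullet> n < - (\<epsilon> * norm h)" using hn lt by simp
      then have "s * (h \<bullet> n) < s * (- (\<epsilon> * norm h))" using s by (rule mult_strict_left_mono)
      then show "(x + s *\<^sub>R h - x) \<bullet> n < - \<epsilon> * norm (x + s *\<^sub>R h - x)"
        using s by (simp add: algebra_simps)
    qed
    then have "\<bar>(x + s *\<^sub>R h) \<bullet> b\<bar> < a \<bullet> b" using b by (auto simp: mem_box abs_less_iff)
    then have "\<sigma> * ((x + s *\<^sub>R h) \<bullet> b) < a \<bullet> b"
      using \<sigma> by (metis abs_ge_self abs_mult mult_1 order_le_less_trans)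
    moreover have "\<sigma> * ((x + s *\<^sub>R h) \<bullet> b) = (\<sigma> * \<sigma>) * (a \<bullet> b) + s * (\<sigma> * (h \<bullet> b))"
      by (simp add: inner_add_left xb algebra_simps)
    ultimately show False using hb lt s \<sigma>2 by (simp add: mult_less_0_iff)
  qed
  moreover have "(norm (n - \<sigma> *\<^sub>R b))\<^sup>2 = 2 - 2 * ((\<sigma> *\<^sub>R b) \<bullet> n)"
    using n1 b \<sigma>2 by (simp add: power2_norm_eq_inner norm_eq_1 inner_diff_left inner_diff_right inner_commute algebra_simps)
  ultimately have "(norm (n - \<sigma> *\<^sub>R b))\<^sup>2 \<le> 0" by simp
  then show ?thesis by simp
qed

lemma frontier_centered_box_cases:
  fixes a :: "'a::euclidean_space"
  assumes "x \<in> frontier (box (- a) a)"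
  obtains b \<sigma> where "b \<in> Basis" "\<bar>\<sigma>\<bar> = 1" "x \<bullet> b = \<sigma> * (a \<bullet> b)"
proof -
  have ne: "box (-a) a \<noteq> {}" using assms by auto
  then have "x \<in> cbox (-a) a - box (-a) a"
    using assms by (simp add: frontier_box)
  then obtain b where "b \<in> Basis" "x \<bullet> b = a \<bullet> b \<or> x \<bullet> b = - (a \<bullet> b)"
    by (fastforce simp: mem_box)
  then show ?thesis using that[of b 1] that[of b "-1"] by auto
qed

lemma outward_normal_box_face:
  fixes a :: "'a::euclidean_space"
  assumes a: "\<And>k. k \<in> Basis \<Longrightarrow> a \<bullet> k > 0" and b: "b \<in> Basis" and \<sigma>: "\<bar>\<sigma>\<bar> = 1"
    and xb: "x \<bullet> b = \<sigma> * (a \<bullet> b)"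
    and xk: "\<And>k. k \<in> Basis \<Longrightarrow> k \<noteq> b \<Longrightarrow> \<bar>x \<bullet> k\<bar> < a \<bullet> k"
  shows "outward_normal (box (- a) a) x (\<sigma> *\<^sub>R b)"
  unfolding outward_normal_def
proof (intro conjI allI impI)
  have \<sigma>': "\<sigma> = 1 \<or> \<sigma> = -1" using \<sigma> by auto
  have ne: "box (-a) a \<noteq> {}" using a by (auto simp: box_ne_empty)
  have "x \<notin> box (-a) a" using \<sigma>' b xb by (auto simp: mem_box intro!: bexI[of _ b])
  moreover have "x \<in> cbox (-a) a"
  proof -
    have "- (a \<bullet> k) \<le> x \<bullet> k \<and> x \<bullet> k \<le> a \<bullet> k" if "k \<in> Basis" for k
      using xk[of k] a[of k] that xb \<sigma>' by (cases "k = b") (auto simp: abs_less_iff)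
    then show ?thesis by (auto simp: mem_box)
  qed
  ultimately show "x \<in> frontier (box (-a) a)" using ne by (simp add: frontier_box)
  show "norm (\<sigma> *\<^sub>R b) = 1" using \<sigma> b by simp
  fix \<epsilon> :: real assume \<epsilon>: "\<epsilon> > 0"
  \<comment> \<open>Within this distance no coordinate reaches a face other than the one through \<open>x\<close>.\<close>
  define \<delta> where "\<delta> = Min ((\<lambda>k. if k = b then a \<bullet> b else a \<bullet> k - \<bar>x \<bullet> k\<bar>) ` Basis)"
  have \<delta>0: "\<delta> > 0" unfolding \<delta>_def using a b xk by (subst Min_gr_iff) auto
  have \<delta>k: "\<delta> \<le> (if k = b then a \<bullet> b else a \<bullet> k - \<bar>x \<bullet> k\<bar>)" if "k \<in> Basis" for k
    unfolding \<delta>_def using that by (intro Min_le) auto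
  have "y \<in> box (-a) a" if y: "y \<in> ball x \<delta>" and neg: "(y - x) \<bullet> (\<sigma> *\<^sub>R b) < - \<epsilon> * norm (y - x)" for y
  proof -
    have "- (a \<bullet> k) < y \<bullet> k \<and> y \<bullet> k < a \<bullet> k" if k: "k \<in> Basis" for k
    proof -
      have "\<bar>(y - x) \<bullet> k\<bar> \<le> norm (y - x)" by (rule Basis_le_norm[OF k])
      also have "\<dots> < \<delta>" using y by (simp add: dist_norm norm_minus_commute)
      finally have *: "\<bar>y \<bullet> k - x \<bullet> k\<bar> < \<delta>" by (simp add: inner_diff_left)
      show ?thesis
      proof (cases "k = b")
        case False
        then show ?thesis using * \<delta>k[OF k] by auto
      next
        case True
        have "(y - x) \<bullet> (\<sigma> *\<^sub>R b) < 0" using neg \<epsilon>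
          by (smt (verit) mult_minus_left mult_nonneg_nonneg norm_ge_zero)
        then have "\<sigma> * (y \<bullet> b - x \<bullet> b) < 0" by (simp add: inner_diff_left)
        then show ?thesis using * \<delta>k[OF k] True \<sigma>' xb a[OF b] by auto
      qed
    qed
    then show ?thesis by (auto simp: mem_box)
  qed
  moreover have "y \<notin> box (-a) a" if pos: "(y - x) \<bullet> (\<sigma> *\<^sub>R b) > \<epsilon> * norm (y - x)" for y
  proof -
    have "\<epsilon> * norm (y - x) \<ge> 0" using \<epsilon> by simp
    with pos have "\<sigma> * (y \<bullet> b - x \<bullet> b) > 0" by (simp add: inner_diff_left)
    then show ?thesis using \<sigma>' xb b by (auto simp: mem_box intro!: bexI[of _ b])
  qed
  ultimately show "\<exists>\<delta>>0. \<forall>y\<in>ball x \<delta>.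
        ((y - x) \<bullet> (\<sigma> *\<^sub>R b) < - \<epsilon> * norm (y - x) \<longrightarrow> y \<in> box (-a) a) \<and>
        ((y - x) \<bullet> (\<sigma> *\<^sub>R b) > \<epsilon> * norm (y - x) \<longrightarrow> y \<notin> box (-a) a)"
    using \<delta>0 by blast
qed

section \<open>The first eigenvalue of a box\<close>

text \<open>
  Points of a closed face, edges and corners included, are limits of points in the relative interior
  of the face, reached by shrinking towards the centre of the face. There the normal exists, and both
  terms of the Robin condition are continuous up to the boundary.
\<close>
lemma robin_condition_closed_face:
  fixes a :: "'a::euclidean_space"
  assumes a: "\<And>k. k \<in> Basis \<Longrightarrow> a \<bullet> k > 0"
    and cu: "continuous_on (closure (box (-a) a)) u" and cg: "continuous_on (closure (box (-a) a)) g"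
    and bc: "\<And>x n. x \<in> frontier (box (-a) a) \<Longrightarrow> outward_normal (box (-a) a) x n \<Longrightarrow> \<beta> * (g x \<bullet> n) + u x = 0"
    and x: "x \<in> closure (box (-a) a)" and b: "b \<in> Basis" and \<sigma>: "\<bar>\<sigma>\<bar> = 1"
    and xb: "x \<bullet> b = \<sigma> * (a \<bullet> b)"
  shows "\<beta> * (g x \<bullet> (\<sigma> *\<^sub>R b)) + u x = 0"
proof -
  \<comment> \<open>The centre of the face.\<close>
  define z where "z = (\<sigma> * (a \<bullet> b)) *\<^sub>R b"
  define y where "y s = x + s *\<^sub>R (z - x)" for s :: real
  have ne: "box (-a) a \<noteq> {}" using a by (auto simp: box_ne_empty)
  have xc: "x \<in> cbox (-a) a" using x ne by simp
  have yb: "y s \<bullet> b = \<sigma> * (a \<bullet> b)" for s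
    using b xb by (simp add: y_def z_def inner_add_left inner_diff_left)
  have yk: "y s \<bullet> k = (1 - s) * (x \<bullet> k)" if "k \<in> Basis" "k \<noteq> b" for s k
    using that b by (simp add: y_def z_def inner_add_left inner_diff_left inner_not_same_Basis algebra_simps)
  have yn: "outward_normal (box (-a) a) (y s) (\<sigma> *\<^sub>R b)" if s: "0 < s" "s \<le> 1" for s
  proof (rule outward_normal_box_face[OF a b \<sigma> yb])
    fix k :: 'a assume k: "k \<in> Basis" "k \<noteq> b"
    have "\<bar>x \<bullet> k\<bar> \<le> a \<bullet> k" using xc k by (auto simp: mem_box abs_le_iff)
    then have "\<bar>y s \<bullet> k\<bar> \<le> (1 - s) * (a \<bullet> k)"
      using s k by (simp add: yk abs_mult mult_left_mono)
    also have "\<dots> < a \<bullet> k" using s a[OF k(1)] by (simp add: algebra_simps)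
    finally show "\<bar>y s \<bullet> k\<bar> < a \<bullet> k" .
  qed
  have yf: "y s \<in> frontier (box (-a) a)" if "0 < s" "s \<le> 1" for s
    using yn[OF that] by (simp add: outward_normal_def)
  have y0: "y 0 = x" by (simp add: y_def)
  have yc: "y ` {0..1} \<subseteq> closure (box (-a) a)"
  proof clarify
    fix s :: real assume "s \<in> {0..1}"
    then show "y s \<in> closure (box (-a) a)"
      using yf[of s] x y0 by (cases "s = 0") (auto simp: frontier_def)
  qed
  have cy: "continuous_on {0..1} y" unfolding y_def by (intro continuous_intros)
  have "\<beta> * (g (y 0) \<bullet> (\<sigma> *\<^sub>R b)) + u (y 0) = 0"
  proof (rule continuous_constant_on_closure[where S="{0<..1}" and f="\<lambda>s. \<beta> * (g (y s) \<bullet> (\<sigma> *\<^sub>R b)) + u (y s)"])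
    have "continuous_on {0..1} (\<lambda>s. \<beta> * (g (y s) \<bullet> (\<sigma> *\<^sub>R b)) + u (y s))"
      by (intro continuous_intros continuous_on_compose2[OF cu cy yc] continuous_on_compose2[OF cg cy yc])
    then show "continuous_on (closure {0<..1}) (\<lambda>s. \<beta> * (g (y s) \<bullet> (\<sigma> *\<^sub>R b)) + u (y s))" by simp
    show "\<beta> * (g (y s) \<bullet> (\<sigma> *\<^sub>R b)) + u (y s) = 0" if "s \<in> {0<..1}" for s
      using that by (intro bc yf yn) auto
  qed simp
  then show ?thesis by (simp add: y0)
qed

lemma robin_eigenfunction_uminus:
  assumes "robin_eigenfunction \<beta> \<Omega> lam u"
  shows "robin_eigenfunction \<beta> \<Omega> lam (\<lambda>x. - u x)"
proof -
  obtain g H where *: "\<exists>x\<in>\<Omega>. u x \<noteq> 0" "continuous_on (closure \<Omega>) u" "continuous_on (closure \<Omega>) g"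
    "\<And>h. continuous_on \<Omega> (\<lambda>x. H x h)"
    "\<And>x. x \<in> \<Omega> \<Longrightarrow> (u has_derivative (\<lambda>h. g x \<bullet> h)) (at x)"
    "\<And>x. x \<in> \<Omega> \<Longrightarrow> (g has_derivative H x) (at x)"
    "\<And>x. x \<in> \<Omega> \<Longrightarrow> (\<Sum>b\<in>Basis. H x b \<bullet> b) + lam * u x = 0"
    "\<And>x n. x \<in> frontier \<Omega> \<Longrightarrow> outward_normal \<Omega> x n \<Longrightarrow> \<beta> * (g x \<bullet> n) + u x = 0"
    using assms unfolding robin_eigenfunction_def by blast
  show ?thesis
    unfolding robin_eigenfunction_def
  proof (intro conjI exI[of _ "\<lambda>x. - g x"] exI[of _ "\<lambda>x h. - H x h"] allI ballI impI)
    show "\<exists>x\<in>\<Omega>. - u x \<noteq> 0" using *(1) by simp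
    fix x assume x: "x \<in> \<Omega>"
    show "((\<lambda>x. - u x) has_derivative (\<lambda>h. - g x \<bullet> h)) (at x)"
      using has_derivative_minus[OF *(5)[OF x]] by simp
    show "((\<lambda>x. - g x) has_derivative (\<lambda>h. - H x h)) (at x)"
      using has_derivative_minus[OF *(6)[OF x]] by simp
    show "(\<Sum>b\<in>Basis. - H x b \<bullet> b) + lam * - u x = 0"
      using *(7)[OF x] by (simp add: sum_negf)
  next
    fix x n assume "x \<in> frontier \<Omega>" "outward_normal \<Omega> x n"
    from *(8)[OF this] show "\<beta> * (- g x \<bullet> n) + - u x = 0" by simp
  qed (auto intro!: continuous_intros *(2-4))
qed

text \<open>
  The comparison described at the beginning: \<open>cos_prod m\<close> is positive on the closed box, and
  assumption \<open>strict\<close> is its boundary inequality \<open>\<beta> \<partial>\<phi>/\<partial>n + \<phi> > 0\<close>, divided by the positive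
  factors that belong to the other coordinates.
\<close>
lemma robin_eigenvalue_box_ge_barrier:
  fixes a :: "'a::euclidean_space"
  assumes \<beta>: "\<beta> \<ge> 0" and a: "\<And>b. b \<in> Basis \<Longrightarrow> a \<bullet> b > 0"
    and m: "\<And>b. b \<in> Basis \<Longrightarrow> 0 \<le> m b \<and> m b * (a \<bullet> b) < pi / 2"
    and strict: "\<And>b. b \<in> Basis \<Longrightarrow> \<beta> * m b * sin (m b * (a \<bullet> b)) < cos (m b * (a \<bullet> b))"
    and ev: "robin_eigenvalue \<beta> (box (-a) a) lam"
  shows "(\<Sum>b\<in>Basis. (m b)\<^sup>2) \<le> lam"
proof -
  let ?\<Omega> = "box (-a) a"
  have ne: "?\<Omega> \<noteq> {}" using a by (auto simp: box_ne_empty)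
  obtain u where u: "robin_eigenfunction \<beta> ?\<Omega> lam u" and upos: "\<exists>x\<in>?\<Omega>. u x > 0"
  proof -
    obtain u where u: "robin_eigenfunction \<beta> ?\<Omega> lam u" using ev unfolding robin_eigenvalue_def by blast
    then obtain x where "x \<in> ?\<Omega>" "u x \<noteq> 0" unfolding robin_eigenfunction_def by blast
    then show thesis
      using that[OF u] that[OF robin_eigenfunction_uminus[OF u]] by (cases "u x > 0") force+
  qed
  obtain g H where cu: "continuous_on (closure ?\<Omega>) u" and cg: "continuous_on (closure ?\<Omega>) g"
    and du: "\<And>x. x \<in> ?\<Omega> \<Longrightarrow> (u has_derivative (\<lambda>h. g x \<bullet> h)) (at x)"
    and dg: "\<And>x. x \<in> ?\<Omega> \<Longrightarrow> (g has_derivative H x) (at x)"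
    and eq: "\<And>x. x \<in> ?\<Omega> \<Longrightarrow> (\<Sum>b\<in>Basis. H x b \<bullet> b) + lam * u x = 0"
    and bc: "\<And>x n. x \<in> frontier ?\<Omega> \<Longrightarrow> outward_normal ?\<Omega> x n \<Longrightarrow> \<beta> * (g x \<bullet> n) + u x = 0"
    using u unfolding robin_eigenfunction_def by blast
  define \<phi> where "\<phi> = cos_prod m"
  define \<Lambda> where "\<Lambda> = (\<Sum>b\<in>Basis. (m b)\<^sup>2)"
  have clo: "closure ?\<Omega> = cbox (-a) a" using ne by simp
  have cospos: "cos (m b * (x \<bullet> b)) > 0" if x: "x \<in> cbox (-a) a" and b: "b \<in> Basis" for x b
  proof -
    have "\<bar>x \<bullet> b\<bar> \<le> a \<bullet> b" using x b by (auto simp: mem_box abs_le_iff)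
    then have "\<bar>m b * (x \<bullet> b)\<bar> \<le> m b * (a \<bullet> b)"
      using m[OF b] by (simp add: abs_mult mult_left_mono)
    then have "\<bar>m b * (x \<bullet> b)\<bar> < pi / 2" using m[OF b] by simp
    then show ?thesis by (intro cos_gt_zero_pi) (auto simp: abs_less_iff)
  qed
  have \<phi>pos: "\<phi> x > 0" if "x \<in> cbox (-a) a" for x
    unfolding \<phi>_def cos_prod_def separable_prod_def using cospos[OF that] by (intro prod_pos) auto
  have "continuous_on (cbox (-a) a) (\<lambda>x. u x / \<phi> x)"
    using cu \<phi>pos unfolding clo \<phi>_def
    by (intro continuous_intros continuous_on_cos_prod) (force dest: \<phi>pos simp: \<phi>_def)+
  then obtain x where x: "x \<in> cbox (-a) a" and xmax: "\<And>y. y \<in> cbox (-a) a \<Longrightarrow> u y / \<phi> y \<le> u x / \<phi> x"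
    using continuous_attains_sup[OF compact_cbox, of "-a" a "\<lambda>x. u x / \<phi> x"] ne box_subset_cbox[of "-a" a] by blast
  define M where "M = u x / \<phi> x"
  have Mpos: "M > 0"
  proof -
    obtain y where y: "y \<in> ?\<Omega>" "u y > 0" using upos by blast
    then have yc: "y \<in> cbox (-a) a" using box_subset_cbox by blast
    have "0 < u y / \<phi> y" using y \<phi>pos[OF yc] by simp
    then show ?thesis using xmax[OF yc] by (simp add: M_def)
  qed
  define v where "v y = u y - M * \<phi> y" for y
  define G where "G y = g y - M *\<^sub>R cos_prod_grad m y" for y
  have ux: "u x = M * \<phi> x" using \<phi>pos[OF x] by (simp add: M_def)
  have vmax: "v y \<le> v x" if y: "y \<in> cbox (-a) a" for y
  proof -
    have "u y / \<phi> y \<le> M" unfolding M_def by (rule xmax[OF y])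
    then have "u y \<le> M * \<phi> y" by (simp only: pos_divide_le_eq[OF \<phi>pos[OF y]])
    then show ?thesis unfolding v_def ux by simp
  qed
  have dv: "(v has_derivative (\<lambda>h. G y \<bullet> h)) (at y)" if "y \<in> ?\<Omega>" for y
    unfolding v_def[abs_def] \<phi>_def G_def inner_diff_left inner_scaleR_left
    by (intro has_derivative_diff du[OF that] has_derivative_mult_right has_derivative_cos_prod)
  have dG: "(G has_derivative (\<lambda>h. H y h - M *\<^sub>R cos_prod_hess m y h)) (at y)" if "y \<in> ?\<Omega>" for y
    unfolding G_def[abs_def]
    by (intro has_derivative_diff dg[OF that] has_derivative_scaleR_right has_derivative_cos_prod_grad)
  have cv: "continuous_on (closure ?\<Omega>) v"
    unfolding v_def[abs_def] \<phi>_def by (intro continuous_intros cu continuous_on_cos_prod)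
  have cG: "continuous_on (closure ?\<Omega>) G"
    unfolding G_def[abs_def] by (intro continuous_intros cg continuous_on_cos_prod_grad)
  have x_int: "x \<in> ?\<Omega>"
  proof (rule ccontr)
    assume "x \<notin> ?\<Omega>"
    then have "x \<in> frontier ?\<Omega>" using x ne by (simp add: frontier_box)
    then obtain b \<sigma> where b: "b \<in> Basis" and \<sigma>: "\<bar>\<sigma>\<bar> = 1" and xb: "x \<bullet> b = \<sigma> * (a \<bullet> b)"
      by (rule frontier_centered_box_cases)
    have \<sigma>2: "\<sigma> * \<sigma> = 1" using \<sigma> by (metis abs_mult_self_eq mult_1)
    have \<sigma>': "\<sigma> = 1 \<or> \<sigma> = -1" using \<sigma> by auto
    \<comment> \<open>Moving \<open>x\<close> inwards, orthogonally to the face, onto the middle hyperplane of the box.\<close>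
    have "x - (\<sigma> * (a \<bullet> b)) *\<^sub>R b \<in> cbox (-a) a"
      using x b xb a by (auto simp: mem_box inner_diff_left inner_Basis less_imp_le)
    then have "G x \<bullet> ((x - (\<sigma> * (a \<bullet> b)) *\<^sub>R b) - x) \<le> 0"
      using max_point_first_order[OF open_box convex_box(2) cv cG, unfolded clo, OF dv x vmax] by blast
    then have "0 \<le> (a \<bullet> b) * (G x \<bullet> (\<sigma> *\<^sub>R b))" by (simp add: mult_ac)
    then have Gb: "G x \<bullet> (\<sigma> *\<^sub>R b) \<ge> 0"
      using a[OF b] by (simp only: zero_le_mult_iff) linarith
    define P where "P = (\<Prod>b'\<in>Basis - {b}. cos (m b' * (x \<bullet> b')))"
    have P: "P > 0" unfolding P_def using cospos[OF x] by (intro prod_pos) auto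
    have \<phi>P: "\<phi> x = cos (m b * (a \<bullet> b)) * P"
      unfolding \<phi>_def cos_prod_def P_def using separable_prod_remove[OF b, of "\<lambda>b t. cos (m b * t)" x] xb \<sigma>' by auto
    have grad: "cos_prod_grad m x \<bullet> (\<sigma> *\<^sub>R b) = - m b * sin (m b * (a \<bullet> b)) * P"
      using cos_prod_grad_component[OF b, of m x] xb \<sigma>' by (auto simp: P_def)
    have "\<beta> * (g x \<bullet> (\<sigma> *\<^sub>R b)) + u x = 0"
      using robin_condition_closed_face[OF a cu cg bc _ b \<sigma> xb] x clo by simp
    then have "\<beta> * (G x \<bullet> (\<sigma> *\<^sub>R b)) = - u x - \<beta> * M * (cos_prod_grad m x \<bullet> (\<sigma> *\<^sub>R b))"
      by (simp add: G_def inner_diff_left algebra_simps)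
    also have "\<dots> = - M * P * (cos (m b * (a \<bullet> b)) - \<beta> * m b * sin (m b * (a \<bullet> b)))"
      unfolding ux \<phi>P grad by (simp add: algebra_simps)
    also have "\<dots> < 0" using Mpos P strict[OF b] by (simp add: mult_pos_pos)
    finally show False using mult_nonneg_nonneg[OF \<beta> Gb] by linarith
  qed
  have "(\<Sum>b\<in>Basis. (H x b - M *\<^sub>R cos_prod_hess m x b) \<bullet> b) \<le> 0"
    by (intro sum_nonpos max_point_second_order[OF open_box x_int _ dv dG[OF x_int]])
      (use vmax box_subset_cbox in auto)
  also have "(\<Sum>b\<in>Basis. (H x b - M *\<^sub>R cos_prod_hess m x b) \<bullet> b)
      = (\<Sum>b\<in>Basis. H x b \<bullet> b) - M * (\<Sum>b\<in>Basis. cos_prod_hess m x b \<bullet> b)"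
    by (simp add: inner_diff_left sum_subtractf sum_distrib_left)
  also have "\<dots> = - (lam * u x) - M * (- \<Lambda> * \<phi> x)"
    using eq[OF x_int] cos_prod_hess_trace[of m x] by (simp add: \<Lambda>_def \<phi>_def)
  also have "\<dots> = (\<Lambda> - lam) * u x"
    unfolding ux by (simp add: algebra_simps)
  finally have "(\<Lambda> - lam) * u x \<le> 0" .
  moreover have "u x > 0" using ux Mpos \<phi>pos[OF x] by simp
  ultimately show ?thesis by (auto simp: mult_le_0_iff \<Lambda>_def)
qed

text \<open>
  The true frequencies satisfy the boundary condition with equality. Multiplying them by \<open>s < 1\<close>
  does not increase the sine term and strictly increases the cosine, which makes the inequality strict. The factor
  is \<open>s = sqrt z\<close> so that the sum of squares gets multiplied by \<open>z\<close>.
\<close>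
lemma robin_eigenvalue_box_ge:
  fixes a :: "'a::euclidean_space"
  assumes \<beta>: "\<beta> \<ge> 0" and a: "\<And>b. b \<in> Basis \<Longrightarrow> a \<bullet> b > 0"
    and m: "\<And>b. b \<in> Basis \<Longrightarrow> 0 < m b \<and> m b * (a \<bullet> b) \<le> pi / 2"
    and robin: "\<And>b. b \<in> Basis \<Longrightarrow> \<beta> * m b * sin (m b * (a \<bullet> b)) = cos (m b * (a \<bullet> b))"
    and ev: "robin_eigenvalue \<beta> (box (-a) a) lam"
  shows "(\<Sum>b\<in>Basis. (m b)\<^sup>2) \<le> lam"
proof (rule field_le_mult_one_interval)
  fix z :: real assume z: "0 < z" "z < 1"
  define s where "s = sqrt z"
  have s: "0 < s" "s < 1" "s\<^sup>2 = z" using z by (auto simp: s_def)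
  have "(\<Sum>b\<in>Basis. (s * m b)\<^sup>2) \<le> lam"
  proof (rule robin_eigenvalue_box_ge_barrier[OF \<beta> a _ _ ev])
    fix b :: 'a assume b: "b \<in> Basis"
    define \<theta> where "\<theta> = m b * (a \<bullet> b)"
    have \<theta>: "0 < \<theta>" "\<theta> \<le> pi / 2" using m[OF b] a[OF b] by (auto simp: \<theta>_def)
    have lt: "s * \<theta> < \<theta>" using s \<theta> by simp
    have s\<theta>: "0 < s * \<theta>" using s \<theta> by simp
    have eq: "s * m b * (a \<bullet> b) = s * \<theta>" by (simp add: \<theta>_def)
    show "0 \<le> s * m b \<and> s * m b * (a \<bullet> b) < pi / 2"
      unfolding eq using s m[OF b] by (intro conjI order_less_le_trans[OF lt \<theta>(2)]) simp
    have 1: "sin (s * \<theta>) \<le> sin \<theta>" using lt s\<theta> \<theta> by (intro sin_monotone_2pi_le) auto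
    have 2: "sin (s * \<theta>) \<ge> 0" using lt s\<theta> \<theta>(2) by (intro sin_ge_zero) linarith+
    have 3: "\<beta> * (s * m b) \<le> \<beta> * m b" using \<beta> s m[OF b] by (intro mult_left_mono) auto
    have "\<beta> * (s * m b) * sin (s * \<theta>) \<le> \<beta> * m b * sin \<theta>"
      by (rule mult_mono[OF 3 1 _ 2]) (use \<beta> m[OF b] in simp)
    also have "\<dots> = cos \<theta>" using robin[OF b] by (simp add: \<theta>_def)
    also have "\<dots> < cos (s * \<theta>)"
      using lt s\<theta> \<theta>(2) pi_gt_zero by (intro cos_monotone_0_pi) linarith+
    finally show "\<beta> * (s * m b) * sin (s * m b * (a \<bullet> b)) < cos (s * m b * (a \<bullet> b))"
      by (simp add: eq)
  qed
  then show "z * (\<Sum>b\<in>Basis. (m b)\<^sup>2) \<le> lam"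
    using s by (simp add: power_mult_distrib flip: sum_distrib_left)
qed

lemma robin_eigenvalue_box:
  fixes a :: "'a::euclidean_space"
  assumes a: "\<And>b. b \<in> Basis \<Longrightarrow> a \<bullet> b > 0"
    and robin: "\<And>b. b \<in> Basis \<Longrightarrow> \<beta> * m b * sin (m b * (a \<bullet> b)) = cos (m b * (a \<bullet> b))"
  shows "robin_eigenvalue \<beta> (box (-a) a) (\<Sum>b\<in>Basis. (m b)\<^sup>2)"
  unfolding robin_eigenvalue_def robin_eigenfunction_def
proof (intro exI[of _ "cos_prod m"] exI[of _ "cos_prod_grad m"] exI[of _ "cos_prod_hess m"] conjI allI ballI impI)
  have "0 \<in> box (-a) a" using a by (auto simp: mem_box)
  moreover have "cos_prod m 0 \<noteq> 0" by (simp add: cos_prod_def separable_prod_def)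
  ultimately show "\<exists>x\<in>box (-a) a. cos_prod m x \<noteq> 0" by blast
  fix x n assume x: "x \<in> frontier (box (-a) a)" and n: "outward_normal (box (-a) a) x n"
  obtain b \<sigma> where b: "b \<in> Basis" and \<sigma>: "\<bar>\<sigma>\<bar> = 1" and xb: "x \<bullet> b = \<sigma> * (a \<bullet> b)"
    using frontier_centered_box_cases[OF x] .
  have \<sigma>': "\<sigma> = 1 \<or> \<sigma> = -1" using \<sigma> by auto
  define P where "P = (\<Prod>b'\<in>Basis - {b}. cos (m b' * (x \<bullet> b')))"
  have "cos_prod m x = cos (m b * (a \<bullet> b)) * P"
    unfolding cos_prod_def P_def using separable_prod_remove[OF b, of "\<lambda>b t. cos (m b * t)" x] xb \<sigma>' by auto
  moreover have "cos_prod_grad m x \<bullet> n = - m b * sin (m b * (a \<bullet> b)) * P"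
    using outward_normal_box_unique[OF n b \<sigma> xb] cos_prod_grad_component[OF b, of m x] xb \<sigma>'
    by (auto simp: P_def)
  ultimately have "\<beta> * (cos_prod_grad m x \<bullet> n) + cos_prod m x
      = P * (cos (m b * (a \<bullet> b)) - \<beta> * m b * sin (m b * (a \<bullet> b)))"
    by (simp add: algebra_simps)
  then show "\<beta> * (cos_prod_grad m x \<bullet> n) + cos_prod m x = 0" using robin[OF b] by simp
qed (auto simp: cos_prod_hess_trace intro!: continuous_on_cos_prod continuous_on_cos_prod_grad
      continuous_on_cos_prod_hess has_derivative_cos_prod has_derivative_cos_prod_grad)

lemma robin_lambda1_box:
  fixes a :: "'a::euclidean_space"
  assumes \<beta>: "\<beta> \<ge> 0" and a: "\<And>b. b \<in> Basis \<Longrightarrow> a \<bullet> b > 0"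
    and m: "\<And>b. b \<in> Basis \<Longrightarrow> 0 < m b \<and> m b * (a \<bullet> b) \<le> pi / 2"
    and robin: "\<And>b. b \<in> Basis \<Longrightarrow> \<beta> * m b * sin (m b * (a \<bullet> b)) = cos (m b * (a \<bullet> b))"
  shows "robin_lambda1 \<beta> (box (-a) a) = (\<Sum>b\<in>Basis. (m b)\<^sup>2)"
  unfolding robin_lambda1_def
  by (rule Least_equality) (use robin_eigenvalue_box robin_eigenvalue_box_ge assms in blast)+

section \<open>The one-dimensional frequency\<close>

lemma tan_frequency_strict_mono:
  fixes c :: real
  assumes "c > 0" "0 < m" "m < m'" "m' < pi / (2 * c)"
  shows "m * tan (c * m) < m' * tan (c * m')"
proof -
  have "c * m' < pi / 2" using assms by (simp add: field_simps)
  moreover have "c * m < c * m'" "0 < c * m" using assms by simp_all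
  ultimately have "0 < tan (c * m)" "tan (c * m) < tan (c * m')"
    by (auto intro!: tan_gt_zero tan_monotone)
  then show ?thesis using assms by (intro mult_strict_mono) auto
qed

lemma robin_mu_ex1:
  fixes c \<beta> :: real
  assumes c: "c > 0" and \<beta>: "\<beta> > 0"
  shows "\<exists>!m. m \<in> {0<..<pi / (2 * c)} \<and> m * tan (c * m) = 1 / \<beta>"
proof -
  \<comment> \<open>Cleared of the denominator \<open>cos (c m)\<close>, the equation extends continuously to the end point \<open>\<pi>/(2 c)\<close>.\<close>
  define f where "f m = \<beta> * m * sin (c * m) - cos (c * m)" for m
  have "\<exists>m\<ge>0. m \<le> pi / (2 * c) \<and> f m = 0"
    by (rule IVT') (use c \<beta> in \<open>auto simp: f_def intro!: continuous_intros\<close>)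
  then obtain m where m: "0 \<le> m" "m \<le> pi / (2 * c)" "f m = 0" by blast
  have "m \<noteq> 0" "m \<noteq> pi / (2 * c)" using m(3) c \<beta> by (auto simp: f_def)
  then have m': "m \<in> {0<..<pi / (2 * c)}" using m by auto
  then have "c * m < pi / 2" "0 < c * m" using c by (auto simp: field_simps)
  then have "cos (c * m) > 0" by (intro cos_gt_zero_pi) auto
  then have "m * tan (c * m) = 1 / \<beta>"
    using m(3) \<beta> by (simp add: f_def tan_def field_simps)
  moreover have "m1 = m2" if "m1 \<in> {0<..<pi / (2 * c)}" "m2 \<in> {0<..<pi / (2 * c)}"
      "m1 * tan (c * m1) = 1 / \<beta>" "m2 * tan (c * m2) = 1 / \<beta>" for m1 m2
    using tan_frequency_strict_mono[OF c, of m1 m2] tan_frequency_strict_mono[OF c, of m2 m1] that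
    by (cases m1 m2 rule: linorder_cases) auto
  ultimately show ?thesis using m' by blast
qed

lemma robin_mu_tan:
  assumes c: "c > 0" and \<beta>: "\<beta> > 0"
  shows "robin_mu \<beta> c \<in> {0<..<pi / (2 * c)}" "robin_mu \<beta> c * tan (c * robin_mu \<beta> c) = 1 / \<beta>"
  using theI'[OF robin_mu_ex1[OF assms]] \<beta> unfolding robin_mu_def by auto

text \<open>
  Cleared of denominators, the equation for the frequency makes sense at \<open>\<theta> = \<pi>/2\<close> too, and thus
  holds for \<open>\<beta> = 0\<close>. It is the boundary condition for \<open>cos (\<mu> t)\<close> at \<open>t = c\<close>.
\<close>
lemma robin_mu_condition:
  assumes c: "c > 0" and \<beta>: "\<beta> \<ge> 0"
  shows "0 < robin_mu \<beta> c" "robin_mu \<beta> c * c \<le> pi / 2"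
    "\<beta> * robin_mu \<beta> c * sin (robin_mu \<beta> c * c) = cos (robin_mu \<beta> c * c)"
proof -
  have "0 < robin_mu \<beta> c \<and> robin_mu \<beta> c * c \<le> pi / 2 \<and>
    \<beta> * robin_mu \<beta> c * sin (robin_mu \<beta> c * c) = cos (robin_mu \<beta> c * c)"
  proof (cases "\<beta> = 0")
    case True
    then have "robin_mu \<beta> c * c = pi / 2" using c by (simp add: robin_mu_def)
    then show ?thesis using True c by (simp add: robin_mu_def)
  next
    case False
    then have \<beta>: "\<beta> > 0" using \<beta> by simp
    note mu = robin_mu_tan[OF c \<beta>]
    have b: "0 < robin_mu \<beta> c * c" "robin_mu \<beta> c * c < pi / 2" using mu(1) c by (auto simp: field_simps)
    then have "cos (robin_mu \<beta> c * c) > 0" by (intro cos_gt_zero_pi) auto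
    then show ?thesis using mu b \<beta> by (simp add: tan_def field_simps)
  qed
  then show "0 < robin_mu \<beta> c" "robin_mu \<beta> c * c \<le> pi / 2"
    "\<beta> * robin_mu \<beta> c * sin (robin_mu \<beta> c * c) = cos (robin_mu \<beta> c * c)" by auto
qed

section \<open>Convexity of the squared frequency in the logarithm of the half-width\<close>

lemma convex_on_if_supporting_lines:
  fixes f :: "real \<Rightarrow> real"
  assumes "\<And>p. \<exists>s. \<forall>q. f p + s * (q - p) \<le> f q"
  shows "convex_on UNIV f"
proof (rule convex_onI)
  fix t x y :: real assume t: "0 < t" "t < 1"
  define p where "p = (1 - t) *\<^sub>R x + t *\<^sub>R y"
  obtain s where s: "\<And>q. f p + s * (q - p) \<le> f q" using assms by blast
  have "(1 - t) * (f p + s * (x - p)) + t * (f p + s * (y - p)) \<le> (1 - t) * f x + t * f y"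
    using t by (intro add_mono mult_left_mono s) auto
  moreover have "(1 - t) * (f p + s * (x - p)) + t * (f p + s * (y - p)) = f p + s * ((1 - t) * x + t * y - p)"
    by (simp add: algebra_simps)
  ultimately show "f ((1 - t) *\<^sub>R x + t *\<^sub>R y) \<le> (1 - t) * f x + t * f y"
    by (simp add: p_def)
qed simp

text \<open>
  Here \<open>s p\<close> is the slope of the curve \<open>(X, Y)\<close> at parameter \<open>p\<close>. The height above the tangent at \<open>p\<close> has
  parameter derivative \<open>(s q - s p) X' q\<close>, nonnegative for \<open>q > p\<close> and nonpositive for \<open>q < p\<close>, so the height is smallest at \<open>p\<close>.
  The parametric form takes the place of differentiating the implicitly defined frequency.
\<close>
lemma parametric_curve_above_tangent:
  fixes X Y s :: "real \<Rightarrow> real"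
  assumes X: "\<And>p. p \<in> {a<..<b} \<Longrightarrow> (X has_real_derivative X' p) (at p)"
    and X': "\<And>p. p \<in> {a<..<b} \<Longrightarrow> X' p > 0"
    and Y: "\<And>p. p \<in> {a<..<b} \<Longrightarrow> (Y has_real_derivative s p * X' p) (at p)"
    and s: "\<And>p q. p \<in> {a<..<b} \<Longrightarrow> q \<in> {a<..<b} \<Longrightarrow> p \<le> q \<Longrightarrow> s p \<le> s q"
    and p: "p \<in> {a<..<b}" and q: "q \<in> {a<..<b}"
  shows "Y p + s p * (X q - X p) \<le> Y q"
proof -
  define D where "D q = Y q - s p * X q" for q
  have D: "(D has_real_derivative (s q - s p) * X' q) (at q)" if "q \<in> {a<..<b}" for q
    unfolding D_def[abs_def] using X[OF that] Y[OF that]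
    by (auto intro!: derivative_eq_intros simp: algebra_simps)
  have "D p \<le> D q"
  proof (cases "p \<le> q")
    case True
    show ?thesis
    proof (rule DERIV_nonneg_imp_nondecreasing[OF True])
      fix r assume "p \<le> r" "r \<le> q"
      then have "r \<in> {a<..<b}" "s p \<le> s r" using s p q by auto
      then show "\<exists>y. (D has_real_derivative y) (at r) \<and> 0 \<le> y"
        using D[of r] X'[of r] by (intro exI conjI) auto
    qed
  next
    case False
    then have "q \<le> p" by simp
    then show ?thesis
    proof (rule DERIV_nonpos_imp_nonincreasing)
      fix r assume "q \<le> r" "r \<le> p"
      then have "r \<in> {a<..<b}" "s r \<le> s p" using s p q by auto
      then show "\<exists>y. (D has_real_derivative y) (at r) \<and> y \<le> 0"
        using D[of r] X'[of r] by (intro exI conjI) (auto simp: mult_le_0_iff)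
    qed
  qed
  then show ?thesis by (simp add: D_def algebra_simps)
qed

text \<open>
  The numerator of the derivative is nonnegative because \<open>sin t cos t \<le> sin t \<le> t\<close>.
\<close>
lemma tan_over_id_mono:
  fixes p q :: real
  assumes "0 < p" "p \<le> q" "q < pi / 2"
  shows "tan p / p \<le> tan q / q"
proof (rule DERIV_nonneg_imp_nondecreasing[OF assms(2)])
  fix t assume "p \<le> t" "t \<le> q"
  then have t: "0 < t" "t < pi / 2" using assms by auto
  then have c: "cos t > 0" by (intro cos_gt_zero_pi) auto
  have "((\<lambda>t. tan t / t) has_real_derivative (inverse ((cos t)\<^sup>2) * t - tan t) / (t * t)) (at t)"
    using t c by (auto intro!: derivative_eq_intros)
  moreover have "tan t \<le> inverse ((cos t)\<^sup>2) * t"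
  proof -
    have "sin t * cos t \<le> sin t * 1" using t by (intro mult_left_mono sin_ge_zero) auto
    also have "\<dots> \<le> t" using t sin_x_le_x[of t] by simp
    finally show ?thesis using c by (simp add: tan_def field_simps power2_eq_square)
  qed
  ultimately show "\<exists>y. ((\<lambda>t. tan t / t) has_real_derivative y) (at t) \<and> 0 \<le> y"
    using t by (intro exI conjI) (auto intro!: divide_nonneg_pos)
qed

text \<open>
  Up to the factor \<open>1 / \<beta>\<^sup>2\<close>, this is the slope of \<open>\<mu>(exp l)\<^sup>2\<close> at parameter \<open>\<theta>\<close>. Splitting its
  denominator into products of the increasing functions \<open>tan\<close>, \<open>sin\<close> and \<open>tan \<theta> / \<theta>\<close> makes
  monotonicity visible; the quotient \<open>\<theta> cot\<^sup>2 \<theta> / (\<theta> + sin \<theta> cos \<theta>)\<close>, which the chain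
  rule gives up to a constant factor, does not.
\<close>
lemma robin_slope_mono:
  fixes p q :: real
  assumes "p \<in> {0<..<pi/2}" "q \<in> {0<..<pi/2}" "p \<le> q"
  shows "- 2 / ((tan p)\<^sup>2 + (sin p)\<^sup>2 * (tan p / p)) \<le> - 2 / ((tan q)\<^sup>2 + (sin q)\<^sup>2 * (tan q / q))"
proof -
  have tp: "tan p > 0" using assms by (intro tan_gt_zero) auto
  have "tan p \<le> tan q" using assms tan_monotone[of p q] by (cases "p = q") auto
  then have 1: "(tan p)\<^sup>2 \<le> (tan q)\<^sup>2" using tp by (intro power_mono) auto
  have sp: "sin p \<ge> 0" "sin p \<le> sin q"
    using assms by (auto intro!: sin_ge_zero sin_monotone_2pi_le)
  have "(sin p)\<^sup>2 * (tan p / p) \<le> (sin q)\<^sup>2 * (tan q / q)"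
    using assms tp sp by (intro mult_mono power_mono tan_over_id_mono) auto
  with 1 have le: "(tan p)\<^sup>2 + (sin p)\<^sup>2 * (tan p / p) \<le> (tan q)\<^sup>2 + (sin q)\<^sup>2 * (tan q / q)" by simp
  moreover have "(tan p)\<^sup>2 + (sin p)\<^sup>2 * (tan p / p) > 0"
    using tp assms by (intro add_pos_nonneg) auto
  ultimately show ?thesis by (simp add: frac_le)
qed

lemma robin_mu_sq_exp_supporting_line:
  assumes \<beta>: "\<beta> > 0"
  shows "\<exists>s. \<forall>q. (robin_mu \<beta> (exp p))\<^sup>2 + s * (q - p) \<le> (robin_mu \<beta> (exp q))\<^sup>2"
proof -
  define \<theta> where "\<theta> l = exp l * robin_mu \<beta> (exp l)" for l
  define X where "X \<theta> = ln \<beta> + ln \<theta> + ln (tan \<theta>)" for \<theta>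
  define X' where "X' \<theta> = 1 / \<theta> + 1 / (sin \<theta> * cos \<theta>)" for \<theta> :: real
  define Y where "Y \<theta> = 1 / (\<beta> * tan \<theta>)\<^sup>2" for \<theta>
  define s where "s \<theta> = (1 / \<beta>\<^sup>2) * (- 2 / ((tan \<theta>)\<^sup>2 + (sin \<theta>)\<^sup>2 * (tan \<theta> / \<theta>)))" for \<theta>
  have \<theta>: "\<theta> l \<in> {0<..<pi/2}" and X\<theta>: "X (\<theta> l) = l" and Y\<theta>: "Y (\<theta> l) = (robin_mu \<beta> (exp l))\<^sup>2" for l
  proof -
    note mu = robin_mu_tan[OF exp_gt_zero[of l] \<beta>]
    show *: "\<theta> l \<in> {0<..<pi/2}" using mu(1) by (auto simp: \<theta>_def field_simps)
    then have t: "tan (\<theta> l) > 0" by (intro tan_gt_zero) auto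
    have mu': "robin_mu \<beta> (exp l) = 1 / (\<beta> * tan (\<theta> l))"
      using mu(2)[folded \<theta>_def] t \<beta> by (simp add: field_simps)
    then show "Y (\<theta> l) = (robin_mu \<beta> (exp l))\<^sup>2" by (simp add: Y_def power_divide)
    have "\<theta> l = exp l * (1 / (\<beta> * tan (\<theta> l)))" using mu' by (simp add: \<theta>_def)
    then have "\<beta> * \<theta> l * tan (\<theta> l) = exp l" using t \<beta> by (simp add: field_simps)
    then have "ln (\<beta> * \<theta> l * tan (\<theta> l)) = l" by simp
    then show "X (\<theta> l) = l" using * t \<beta> by (simp add: X_def ln_mult)
  qed
  have "Y (\<theta> p) + s (\<theta> p) * (X (\<theta> q) - X (\<theta> p)) \<le> Y (\<theta> q)" for q
  proof (rule parametric_curve_above_tangent[where a=0 and b="pi/2" and X'=X'])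
    fix t :: real assume t: "t \<in> {0<..<pi/2}"
    then have c: "cos t > 0" and sn: "sin t > 0" by (auto intro!: cos_gt_zero_pi sin_gt_zero)
    then have tn: "tan t > 0" by (simp add: tan_def)
    have "(X has_real_derivative 0 + 1 / t + inverse ((cos t)\<^sup>2) / tan t) (at t)"
      unfolding X_def[abs_def] using t c tn by (auto intro!: derivative_eq_intros)
    also have "0 + 1 / t + inverse ((cos t)\<^sup>2) / tan t = X' t"
      using c by (simp add: X'_def tan_def power2_eq_square divide_simps)
    finally show "(X has_real_derivative X' t) (at t)" .
    show "X' t > 0" unfolding X'_def using t c sn by (intro add_pos_pos) auto
    have "(Y has_real_derivative
        - (2 * (\<beta> * tan t) * (\<beta> * inverse ((cos t)\<^sup>2))) / ((\<beta> * tan t)\<^sup>2 * (\<beta> * tan t)\<^sup>2)) (at t)"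
      unfolding Y_def[abs_def] using c tn \<beta>
      by (auto intro!: derivative_eq_intros)
    also have "- (2 * (\<beta> * tan t) * (\<beta> * inverse ((cos t)\<^sup>2))) / ((\<beta> * tan t)\<^sup>2 * (\<beta> * tan t)\<^sup>2)
        = - 2 * cos t / (\<beta>\<^sup>2 * sin t ^ 3)"
      using c sn \<beta> by (simp add: tan_def divide_simps power2_eq_square power3_eq_cube)
    also have "- 2 * cos t / (\<beta>\<^sup>2 * sin t ^ 3) = s t * X' t"
    proof -
      have e1: "X' t = (sin t * cos t + t) / (t * (sin t * cos t))"
        using t c sn by (simp add: X'_def field_simps)
      have e2: "(tan t)\<^sup>2 + (sin t)\<^sup>2 * (tan t / t) = (sin t)\<^sup>2 * (t + sin t * cos t) / (t * (cos t)\<^sup>2)"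
        using t c sn by (simp add: tan_def field_simps power2_eq_square)
      have "t + sin t * cos t > 0" using t c sn by (simp add: add_pos_pos)
      then have "1 / \<beta>\<^sup>2 * (- 2 / ((sin t)\<^sup>2 * K / (t * (cos t)\<^sup>2))) * (K / (t * (sin t * cos t)))
          = - 2 * cos t / (\<beta>\<^sup>2 * sin t ^ 3)" if "K > 0" for K
        using t c sn \<beta> that by (simp add: divide_simps power2_eq_square power3_eq_cube)
      from this[of "t + sin t * cos t"] \<open>t + sin t * cos t > 0\<close>
      show ?thesis unfolding s_def e1 e2 by (simp add: add.commute)
    qed
    finally show "(Y has_real_derivative s t * X' t) (at t)" .
  next
    fix t r :: real assume "t \<in> {0<..<pi/2}" "r \<in> {0<..<pi/2}" "t \<le> r"
    from robin_slope_mono[OF this] show "s t \<le> s r"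
      unfolding s_def by (rule mult_left_mono) simp
  qed (use \<theta> in auto)
  then show ?thesis unfolding X\<theta> Y\<theta> by blast
qed

text \<open>
  The case \<open>\<theta> = \<pi>/2\<close>, outside the range of the parametrisation, reduces to \<open>1 + x \<le> exp x\<close>.
\<close>
lemma dirichlet_mu_sq_exp_supporting_line:
  "\<exists>s. \<forall>q. (robin_mu 0 (exp p))\<^sup>2 + s * (q - p) \<le> (robin_mu 0 (exp q))\<^sup>2"
proof (intro exI allI)
  fix q
  define K where "K = pi\<^sup>2 / 4"
  have mu: "(robin_mu 0 (exp l))\<^sup>2 = K * exp (- 2 * l)" for l
  proof -
    have "exp (- 2 * l) = 1 / (exp l)\<^sup>2"
      by (simp add: exp_minus exp_double inverse_eq_divide)
    then show ?thesis by (simp add: robin_mu_def K_def power_divide power_mult_distrib)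
  qed
  have "K * exp (- 2 * p) * (1 + (- 2 * (q - p))) \<le> K * exp (- 2 * p) * exp (- 2 * (q - p))"
    by (intro mult_left_mono exp_ge_add_one_self) (simp add: K_def)
  also have "\<dots> = K * exp (- 2 * q)" by (simp add: mult.assoc algebra_simps flip: exp_add)
  finally show "(robin_mu 0 (exp p))\<^sup>2 + (- 2 * K * exp (- 2 * p)) * (q - p) \<le> (robin_mu 0 (exp q))\<^sup>2"
    unfolding mu by (simp add: algebra_simps)
qed

lemma convex_on_robin_mu_sq_exp:
  assumes "\<beta> \<ge> 0"
  shows "convex_on UNIV (\<lambda>l. (robin_mu \<beta> (exp l))\<^sup>2)"
  using assms robin_mu_sq_exp_supporting_line dirichlet_mu_sq_exp_supporting_line
  by (cases "\<beta> = 0") (auto intro!: convex_on_if_supporting_lines)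

section \<open>Convexity in the logarithms of the side lengths\<close>

lemma sum_Basis_inner_vec:
  fixes a :: "real ^ 'n"
  shows "(\<Sum>b\<in>Basis. f (a \<bullet> b)) = (\<Sum>j\<in>UNIV. f (a $ j))"
proof -
  have B: "(Basis :: (real ^ 'n) set) = range (\<lambda>j. axis j 1)" by (auto simp: Basis_vec_def)
  have "inj (\<lambda>j. axis j 1 :: real ^ 'n)" by (auto simp: inj_on_def axis_eq_axis)
  then show ?thesis by (simp add: B sum.reindex inner_axis)
qed

lemma robin_lambda1_centered_box:
  fixes a :: "real ^ 'n"
  assumes \<beta>: "\<beta> \<ge> 0" and a: "\<And>j. a $ j > 0"
  shows "robin_lambda1 \<beta> (centered_box a) = (\<Sum>j\<in>UNIV. (robin_mu \<beta> (a $ j))\<^sup>2)"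
proof -
  have pos: "a \<bullet> b > 0" if "b \<in> Basis" for b
    using that a by (auto simp: Basis_vec_def inner_axis)
  have "robin_lambda1 \<beta> (box (- a) a) = (\<Sum>b\<in>Basis. (robin_mu \<beta> (a \<bullet> b))\<^sup>2)"
    by (rule robin_lambda1_box[OF \<beta> pos]) (use robin_mu_condition[OF pos \<beta>] in auto)
  then show ?thesis by (simp add: centered_box_def sum_Basis_inner_vec[where f="\<lambda>c. (robin_mu \<beta> c)\<^sup>2"])
qed

lemma convex_on_robin_lambda1_exp:
  assumes \<beta>: "\<beta> \<ge> 0"
  shows "convex_on UNIV (\<lambda>l :: real ^ 'n. robin_lambda1 \<beta> (centered_box (\<chi> j. exp (l $ j))))"
proof (rule convex_onI)
  fix t :: real and x y :: "real ^ 'n"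
  assume t: "0 < t" "t < 1"
  let ?f = "\<lambda>l. (robin_mu \<beta> (exp l))\<^sup>2"
  have "(\<Sum>j\<in>UNIV. ?f ((1 - t) * x $ j + t * y $ j)) \<le> (\<Sum>j\<in>UNIV. (1 - t) * ?f (x $ j) + t * ?f (y $ j))"
  proof (rule sum_mono)
    fix j
    show "?f ((1 - t) * x $ j + t * y $ j) \<le> (1 - t) * ?f (x $ j) + t * ?f (y $ j)"
      using convex_onD[OF convex_on_robin_mu_sq_exp[OF \<beta>], of t "x $ j" "y $ j"] t by simp
  qed
  then show "robin_lambda1 \<beta> (centered_box (\<chi> j. exp (((1 - t) *\<^sub>R x + t *\<^sub>R y) $ j)))
      \<le> (1 - t) * robin_lambda1 \<beta> (centered_box (\<chi> j. exp (x $ j)))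
        + t * robin_lambda1 \<beta> (centered_box (\<chi> j. exp (y $ j)))"
    by (simp add: robin_lambda1_centered_box[OF \<beta>] sum.distrib sum_distrib_left)
qed simp

theorem theorem8:
  fixes \<beta> :: real
  assumes "\<beta> \<ge> 0"
  shows "(\<forall>a :: real ^ 'n. (\<forall>j. a $ j > 0) \<longrightarrow>
            robin_lambda1 \<beta> (centered_box a) = (\<Sum>j\<in>UNIV. (robin_mu \<beta> (a $ j))\<^sup>2))
       \<and> convex_on UNIV
            (\<lambda>l :: real ^ 'n. robin_lambda1 \<beta> (centered_box (\<chi> j. exp (l $ j))))
       \<and> (\<forall>(a0 :: real ^ 'n) (a1 :: real ^ 'n) t.
            (\<forall>j. a0 $ j > 0) \<and> (\<forall>j. a1 $ j > 0) \<and> 0 < t \<and> t < 1 \<longrightarrow>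
            robin_lambda1 \<beta> (centered_box (\<chi> j. (a0 $ j) powr (1 - t) * (a1 $ j) powr t))
              \<le> (1 - t) * robin_lambda1 \<beta> (centered_box a0)
                + t * robin_lambda1 \<beta> (centered_box a1))"
proof (intro conjI allI impI)
  show "robin_lambda1 \<beta> (centered_box a) = (\<Sum>j\<in>UNIV. (robin_mu \<beta> (a $ j))\<^sup>2)"
    if "\<forall>j. a $ j > 0" for a :: "real ^ 'n"
    using that by (intro robin_lambda1_centered_box[OF assms]) auto
  show convex: "convex_on UNIV
      (\<lambda>l :: real ^ 'n. robin_lambda1 \<beta> (centered_box (\<chi> j. exp (l $ j))))"
    by (rule convex_on_robin_lambda1_exp[OF assms])
  fix a0 a1 :: "real ^ 'n" and t :: real
  assume *: "(\<forall>j. a0 $ j > 0) \<and> (\<forall>j. a1 $ j > 0) \<and> 0 < t \<and> t < 1"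
  define l0 :: "real ^ 'n" where "l0 = (\<chi> j. ln (a0 $ j))"
  define l1 :: "real ^ 'n" where "l1 = (\<chi> j. ln (a1 $ j))"
  have "(\<chi> j. exp (l0 $ j)) = a0" "(\<chi> j. exp (l1 $ j)) = a1"
    using * by (simp_all add: l0_def l1_def vec_eq_iff)
  moreover have "(\<chi> j. exp (((1 - t) *\<^sub>R l0 + t *\<^sub>R l1) $ j))
      = (\<chi> j. (a0 $ j) powr (1 - t) * (a1 $ j) powr t)"
    using * by (auto simp: l0_def l1_def vec_eq_iff powr_def exp_add less_imp_neq[THEN not_sym])
  ultimately show "robin_lambda1 \<beta> (centered_box (\<chi> j. (a0 $ j) powr (1 - t) * (a1 $ j) powr t))
      \<le> (1 - t) * robin_lambda1 \<beta> (centered_box a0) + t * robin_lambda1 \<beta> (centered_box a1)"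
    using convex_onD[OF convex, of t l0 l1] * by simp
qed

end
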